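(* Let $f:\mathbb{R}^n\to\mathbb{R}$ be twice continuously differentiable and convex. Then $z^\star$ is a second-order KKT point of the problem $(\mathrm{P_{1b}})$ of minimizing $g(z)=f(z\odot z)$ over $z\in\mathcal{S}_{n-1}$ if and only if $x^\star=z^\star\odot z^\star$ is a global minimizer of $f$ over $\Delta_n$.
   Context: Notation: $\odot$ is the entrywise product; $\Delta_n=\{x\in\mathbb{R}^n:\sum_i [x]_i=1,\ x\ge 0\}$; $\mathcal{S}_{n-1}=\{z\in\mathbb{R}^n:\|z\|_2=1\}$. A point $z^\star$ is a second-order KKT point of $(\mathrm{P_{1b}})$ if there exists $\lambda_N^\star\in\mathbb{R}$ with $\nabla f(z^\star\odot z^\star)\odot z^\star=\lambda_N^\star z^\star$, $\|z^\star\|_2^2=1$, and, for all $d\in\mathbb{R}^n$ with $d\perp z^\star$, $$2\langle\nabla f(z^\star\odot z^\star),d\odot d\rangle-2\lambda_N^\star\|d\|_2^2+4(z^\star\odot d)^\top\nabla^2 f(z^\star\odot z^\star)(z^\star\odot d)\ge 0.$$ *)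

theory Defs
  imports "HOL-Analysis.Analysis"
begin

(* Multiplication on real ^ 'n is entrywise. *)
abbreviation hadamard :: "real ^ 'n \<Rightarrow> real ^ 'n \<Rightarrow> real ^ 'n"  (infixl \<open>\<odot>\<close> 70)
  where "x \<odot> y \<equiv> x * y"

definition gradient :: "(real ^ 'n \<Rightarrow> real) \<Rightarrow> real ^ 'n \<Rightarrow> real ^ 'n"
  where "gradient f x = (THE D. GDERIV f x :> D)"

(* The Hessian is the Jacobian matrix of the gradient map.  As with the gradient, its value is
   meaningful only where the derivative in question exists. *)
definition hessian :: "(real ^ 'n \<Rightarrow> real) \<Rightarrow> real ^ 'n \<Rightarrow> real ^ 'n ^ 'n"
  where "hessian f x = matrix (frechet_derivative (gradient f) (at x))"

definition twice_continuously_differentiable :: "(real ^ 'n \<Rightarrow> real) \<Rightarrow> bool"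
  where "twice_continuously_differentiable f \<longleftrightarrow>
    (\<forall>x. f differentiable (at x)) \<and>
    (\<forall>x. gradient f differentiable (at x)) \<and>
    continuous_on UNIV (hessian f)"

definition unit_simplex :: "(real ^ 'n) set"
  where "unit_simplex = {x. (\<Sum>i\<in>UNIV. x $ i) = 1 \<and> (\<forall>i. 0 \<le> x $ i)}"

(* Second-order KKT points of the problem: minimize f (z \<odot> z) over norm z = 1.
   The conditions are expressed through the derivatives of f itself; the multiplier l is
   that of the sphere constraint. *)
definition second_order_KKT :: "(real ^ 'n \<Rightarrow> real) \<Rightarrow> real ^ 'n \<Rightarrow> bool"
  where "second_order_KKT f z \<longleftrightarrow>
    (\<exists>l::real.
      gradient f (z \<odot> z) \<odot> z = l *\<^sub>R z \<and>
      (norm z)\<^sup>2 = 1 \<and>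
      (\<forall>d. orthogonal d z \<longrightarrow>
        2 * (gradient f (z \<odot> z) \<bullet> (d \<odot> d)) - 2 * l * (norm d)\<^sup>2
          + 4 * ((z \<odot> d) \<bullet> (hessian f (z \<odot> z) *v (z \<odot> d))) \<ge> 0))"

end

theory Submission
  imports Defs
begin

text \<open>
  Put \<open>x = z \<odot> z\<close> and \<open>G = \<nabla>f(x)\<close>. Both sides are equivalent to: \<open>x\<close> lies in the simplex, and for
  some \<open>l\<close> we have \<open>G\<^sub>i \<ge> l\<close> for all \<open>i\<close>, with equality wherever \<open>z\<^sub>i \<noteq> 0\<close>. At a second-order KKT
  point, the inequality at an index with \<open>z\<^sub>i = 0\<close> comes from testing the curvature condition with
  the unit vector \<open>e\<^sub>i\<close>, which kills the Hessian term; convexity then makes \<open>x\<close> a global minimizer.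
  Conversely, a minimizer satisfies these conditions with \<open>l = G \<bullet> x\<close>, and the Hessian term
  is nonnegative because the gradient of a convex function is monotone.
\<close>

text \<open>Makes the definite description in \<open>gradient\<close> usable: a vector representing
  the derivative exists by Riesz representation and is unique because the inner product separates
  vectors.\<close>

lemma GDERIV_gradient:
  fixes f :: "real ^ 'n \<Rightarrow> real"
  assumes "f differentiable (at x)"
  shows "GDERIV f x :> gradient f x"
proof -
  obtain f' where f': "(f has_derivative f') (at x)"
    using assms by (auto simp: differentiable_def)
  \<comment> \<open>The Riesz vector of a linear functional is its adjoint applied to the scalar
    1.\<close>
  have "f' = (\<lambda>h. h \<bullet> adjoint f' 1)"
    using adjoint_works[OF has_derivative_linear[OF f']] by fastforce
  with f' have D: "GDERIV f x :> adjoint f' 1"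
    by (simp add: gderiv_def)
  show ?thesis
    unfolding gradient_def
  proof (rule theI[where P = "\<lambda>D. GDERIV f x :> D", OF D])
    fix E assume "GDERIV f x :> E"
    then have "(\<lambda>h. h \<bullet> E) = (\<lambda>h. h \<bullet> adjoint f' 1)"
      unfolding gderiv_def by (rule has_derivative_unique[OF _ D[unfolded gderiv_def]])
    then show "E = adjoint f' 1"
      by (metis vector_eq_ldot)
  qed
qed

lemma GDERIV_along_line:
  assumes "GDERIV f x :> G"
  shows "((\<lambda>t. f (x + t *\<^sub>R w)) has_real_derivative w \<bullet> G) (at 0)"
proof -
  have "((\<lambda>t. x + t *\<^sub>R w) has_derivative (\<lambda>t. t *\<^sub>R w)) (at 0)"
    by (auto intro!: derivative_eq_intros)
  moreover have "(f has_derivative (\<lambda>h. h \<bullet> G)) (at (x + 0 *\<^sub>R w))"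
    using assms by (simp add: gderiv_def)
  ultimately have "((\<lambda>t. f (x + t *\<^sub>R w)) has_derivative (\<lambda>t. (t *\<^sub>R w) \<bullet> G)) (at 0)"
    by (rule has_derivative_compose)
  moreover have "(\<lambda>t. (t *\<^sub>R w) \<bullet> G) = (*) (w \<bullet> G)"
    by (simp add: fun_eq_iff)
  ultimately show ?thesis
    by (simp add: has_field_derivative_def)
qed

text \<open>A negative derivative would make \<phi> drop just to the right of 0. The one-sided form
  on (0, 1] suits a segment starting at a boundary point of a convex set.\<close>

lemma DERIV_nonneg_at_right_min:
  fixes \<phi> :: "real \<Rightarrow> real"
  assumes "(\<phi> has_real_derivative D) (at 0)"
    and "\<And>t. 0 < t \<Longrightarrow> t \<le> 1 \<Longrightarrow> \<phi> 0 \<le> \<phi> t"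
  shows "0 \<le> D"
proof (rule ccontr)
  assume "\<not> 0 \<le> D"
  then obtain e where "e > 0" and e: "\<And>h. 0 < h \<Longrightarrow> h < e \<Longrightarrow> \<phi> (0 + h) < \<phi> 0"
    using DERIV_neg_dec_right[OF assms(1)] by force
  \<comment> \<open>This point lies both in (0, e), where \<phi> is below its value at 0, and in (0,
    1], where it is not.\<close>
  have "\<phi> (min 1 (e / 2)) < \<phi> 0"
    using e[of "min 1 (e / 2)"] \<open>e > 0\<close> by auto
  moreover have "\<phi> 0 \<le> \<phi> (min 1 (e / 2))"
    using assms(2) \<open>e > 0\<close> by simp
  ultimately show False by simp
qed

text \<open>Restricting to the line through x and y reduces this to the tangent inequality for a
  convex function of one real variable, taken between 0 and 1.\<close>

lemma convex_on_above_gradient: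
  assumes "convex_on UNIV f" and "GDERIV f x :> G"
  shows "(y - x) \<bullet> G \<le> f y - f x"
proof -
  define \<phi> where "\<phi> = (\<lambda>t. f (x + t *\<^sub>R (y - x)))"
  have "convex_on UNIV \<phi>"
  proof (rule convex_onI)
    fix t a b :: real
    assume t: "0 < t" "t < 1"
    have "x + ((1 - t) *\<^sub>R a + t *\<^sub>R b) *\<^sub>R (y - x)
        = (1 - t) *\<^sub>R (x + a *\<^sub>R (y - x)) + t *\<^sub>R (x + b *\<^sub>R (y - x))"
      by (simp add: algebra_simps)
    then show "\<phi> ((1 - t) *\<^sub>R a + t *\<^sub>R b) \<le> (1 - t) * \<phi> a + t * \<phi> b"
      using convex_onD[OF assms(1), of t] t unfolding \<phi>_def by simp
  qed simp
  moreover have "(\<phi> has_real_derivative (y - x) \<bullet> G) (at 0)"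
    using GDERIV_along_line[OF assms(2)] by (simp add: \<phi>_def)
  ultimately have "\<phi> 1 - \<phi> 0 \<ge> ((y - x) \<bullet> G) * (1 - 0)"
    by (intro convex_on_imp_above_tangent) auto
  then show ?thesis
    by (simp add: \<phi>_def)
qed

text \<open>The quadratic form is the derivative at t = 0 of the slope of f in direction w at x + t
  w. By monotonicity of the gradient, this slope is at t = 0 no larger than at any t > 0.\<close>

lemma convex_on_hessian_nonneg:
  fixes f :: "real ^ 'n \<Rightarrow> real"
  assumes "convex_on UNIV f" and f: "\<And>x. f differentiable (at x)"
    and "gradient f differentiable (at x)"
  shows "0 \<le> w \<bullet> (hessian f x *v w)"
proof -
  let ?D = "frechet_derivative (gradient f) (at x)"
  have D: "(gradient f has_derivative ?D) (at x)"
    using assms(3) frechet_derivative_works by blast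
  have "((\<lambda>y. gradient f y \<bullet> w) has_derivative (\<lambda>h. ?D h \<bullet> w)) (at x)"
    using D by (rule has_derivative_inner_left)
  moreover have "((\<lambda>t. x + t *\<^sub>R w) has_derivative (\<lambda>t. t *\<^sub>R w)) (at 0)"
    by (auto intro!: derivative_eq_intros)
  ultimately have "((\<lambda>t. gradient f (x + t *\<^sub>R w) \<bullet> w) has_derivative (\<lambda>t. ?D (t *\<^sub>R w) \<bullet> w)) (at 0)"
    using has_derivative_compose[of "\<lambda>t. x + t *\<^sub>R w" _ 0 UNIV "\<lambda>y. gradient f y \<bullet> w"] by simp
  moreover have "?D (t *\<^sub>R w) \<bullet> w = (?D w \<bullet> w) * t" for t
    using has_derivative_linear[OF D] by (simp add: linear_cmul)
  ultimately have "((\<lambda>t. gradient f (x + t *\<^sub>R w) \<bullet> w) has_real_derivative ?D w \<bullet> w) (at 0)"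
    by (simp add: has_field_derivative_def)
  moreover have "gradient f (x + 0 *\<^sub>R w) \<bullet> w \<le> gradient f (x + t *\<^sub>R w) \<bullet> w" if "0 < t" for t
  proof -
    \<comment> \<open>Adding the tangent inequalities based at the two endpoints cancels the values
      of f; dividing by t then compares the slopes.\<close>
    have "(t *\<^sub>R w) \<bullet> gradient f x \<le> f (x + t *\<^sub>R w) - f x"
      using convex_on_above_gradient[OF assms(1) GDERIV_gradient[OF f], of "x + t *\<^sub>R w" x] by simp
    moreover have "- ((t *\<^sub>R w) \<bullet> gradient f (x + t *\<^sub>R w)) \<le> f x - f (x + t *\<^sub>R w)"
      using convex_on_above_gradient[OF assms(1) GDERIV_gradient[OF f], of x "x + t *\<^sub>R w"] by simp
    ultimately have "t * (w \<bullet> gradient f x) \<le> t * (w \<bullet> gradient f (x + t *\<^sub>R w))"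
      by simp
    then show ?thesis
      using that by (simp add: inner_commute)
  qed
  ultimately have "0 \<le> ?D w \<bullet> w"
    by (rule DERIV_nonneg_at_right_min)
  then show ?thesis
    using matrix_works[of ?D w] has_derivative_linear[OF D]
    by (simp add: hessian_def inner_commute linear_matrix_vector_mul_eq)
qed

text \<open>First-order necessary condition: f restricted to the segment from x to y, which stays in
  S, has its minimum at the starting point.\<close>

lemma min_over_convex_GDERIV_nonneg:
  assumes "convex S" "x \<in> S" "y \<in> S" "\<And>y. y \<in> S \<Longrightarrow> f x \<le> f y" "GDERIV f x :> G"
  shows "0 \<le> (y - x) \<bullet> G"
proof (rule DERIV_nonneg_at_right_min[OF GDERIV_along_line[OF assms(5)]])
  fix t :: real assume "0 < t" "t \<le> 1"
  then have "(1 - t) *\<^sub>R x + t *\<^sub>R y \<in> S"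
    using convexD_alt[OF assms(1-3)] by simp
  then have "x + t *\<^sub>R (y - x) \<in> S"
    by (simp add: algebra_simps)
  then show "f (x + 0 *\<^sub>R (y - x)) \<le> f (x + t *\<^sub>R (y - x))"
    using assms(4) by simp
qed

lemma convex_unit_simplex: "convex (unit_simplex :: (real ^ 'n) set)"
  by (auto simp: convex_def unit_simplex_def sum.distrib simp flip: sum_distrib_left)

lemma axis_in_unit_simplex: "axis i 1 \<in> unit_simplex"
  by (auto simp: unit_simplex_def axis_def)

lemma hadamard_self_in_unit_simplex: "z \<odot> z \<in> unit_simplex \<longleftrightarrow> (norm z)\<^sup>2 = 1"
  by (simp add: unit_simplex_def power2_norm_eq_inner inner_vec_def)

text \<open>Since the weights \<open>x $ j\<close> sum to 1, \<open>x \<bullet> G\<close> is a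
  weighted average of the entries of G. Testing with the vertices shows that no entry is below this
  average, so every entry of positive weight equals it.\<close>

lemma complementarity_if_minimizer:
  fixes x G :: "real ^ 'n"
  assumes "x \<in> unit_simplex" and "\<And>y. y \<in> unit_simplex \<Longrightarrow> 0 \<le> (y - x) \<bullet> G"
  shows "x \<bullet> G \<le> G $ i" and "x $ i = 0 \<or> G $ i = x \<bullet> G"
proof -
  have ge: "x \<bullet> G \<le> G $ j" for j
    using assms(2)[OF axis_in_unit_simplex[of j]] by (simp add: inner_diff_left inner_axis')
  show "x \<bullet> G \<le> G $ i" by (rule ge)
  have sum1: "(\<Sum>j\<in>UNIV. x $ j) = 1" and nonneg: "\<And>j. 0 \<le> x $ j"
    using assms(1) by (auto simp: unit_simplex_def)
  \<comment> \<open>Weighted deviations from the average sum to zero; being nonnegative, each of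
    them vanishes.\<close>
  have "(\<Sum>j\<in>UNIV. x $ j * (G $ j - x \<bullet> G)) = x \<bullet> G - (\<Sum>j\<in>UNIV. x $ j) * (x \<bullet> G)"
    by (simp add: right_diff_distrib sum_subtractf inner_vec_def[of x G] sum_distrib_right)
  also have "\<dots> = 0"
    using sum1 by simp
  finally have "\<forall>j\<in>UNIV. x $ j * (G $ j - x \<bullet> G) = 0"
    using ge nonneg by (subst (asm) sum_nonneg_eq_0_iff) auto
  then show "x $ i = 0 \<or> G $ i = x \<bullet> G" by simp
qed

lemma second_order_KKT_imp_min:
  fixes f :: "real ^ 'n \<Rightarrow> real"
  assumes "convex_on UNIV f" and f: "\<And>x. f differentiable (at x)" and "second_order_KKT f z"
  shows "is_arg_min f (\<lambda>x. x \<in> unit_simplex) (z \<odot> z)"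
proof -
  let ?x = "z \<odot> z"
  let ?G = "gradient f ?x"
  obtain l where stat: "?G \<odot> z = l *\<^sub>R z" and norm1: "(norm z)\<^sup>2 = 1"
    and curv: "\<And>d. orthogonal d z \<Longrightarrow> 2 * (?G \<bullet> (d \<odot> d)) - 2 * l * (norm d)\<^sup>2
          + 4 * ((z \<odot> d) \<bullet> (hessian f ?x *v (z \<odot> d))) \<ge> 0"
    using assms(3) unfolding second_order_KKT_def by blast
  have stat_i: "?G $ i * z $ i = l * z $ i" for i
    using arg_cong[OF stat, of "\<lambda>v. v $ i"] by simp
  have ge: "l \<le> ?G $ i" for i
  proof (cases "z $ i = 0")
    case True
    then have "orthogonal (axis i 1) z"
      by (simp add: orthogonal_def inner_axis')
    moreover have "z \<odot> axis i 1 = 0"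
      using True by (simp add: vec_eq_iff axis_def)
    moreover have "axis i 1 \<odot> axis i 1 = (axis i 1 :: real ^ 'n)"
      by (simp add: vec_eq_iff axis_def)
    ultimately show ?thesis
      using curv[of "axis i 1"] by (simp add: inner_axis)
  next
    case False
    then show ?thesis using stat_i[of i] by simp
  qed
  have x: "?x \<in> unit_simplex"
    using norm1 by (simp add: hadamard_self_in_unit_simplex)
  \<comment> \<open>The linear functional given by \<open>?G\<close> equals l at \<open>?x\<close>
    and is at least l at y, since both points have coordinate sum 1. The tangent inequality at
    \<open>?x\<close> carries this over to f.\<close>
  have "f ?x \<le> f y" if "y \<in> unit_simplex" for y
  proof -
    have sum1: "(\<Sum>i\<in>UNIV. y $ i) = 1" and nonneg: "\<And>i. 0 \<le> y $ i"
      using that by (auto simp: unit_simplex_def)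
    have "?x \<bullet> ?G = (\<Sum>i\<in>UNIV. l * ?x $ i)"
      unfolding inner_vec_def
    proof (rule sum.cong)
      fix i
      show "?x $ i \<bullet> ?G $ i = l * ?x $ i"
        \<comment> \<open>Multiplying stationarity by \<open>z $ i\<close> turns it into a relation
          in \<open>?x\<close>.\<close>
        using arg_cong[OF stat_i[of i], of "\<lambda>s. z $ i * s"] by (simp add: ac_simps)
    qed simp
    also have "\<dots> = (\<Sum>i\<in>UNIV. l * y $ i)"
      using x sum1 by (simp add: unit_simplex_def flip: sum_distrib_left)
    also have "\<dots> \<le> y \<bullet> ?G"
      unfolding inner_vec_def using ge nonneg
      by (intro sum_mono) (simp add: mult.commute[of l] mult_left_mono)
    finally show ?thesis
      using convex_on_above_gradient[OF assms(1) GDERIV_gradient[OF f], of y ?x]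
      by (simp add: inner_diff_left)
  qed
  then show ?thesis
    using x by (force simp: is_arg_min_def)
qed

lemma min_imp_second_order_KKT:
  fixes f :: "real ^ 'n \<Rightarrow> real"
  assumes "convex_on UNIV f" and f: "\<And>x. f differentiable (at x)"
    and "\<And>x. gradient f differentiable (at x)"
    and min: "is_arg_min f (\<lambda>x. x \<in> unit_simplex) (z \<odot> z)"
  shows "second_order_KKT f z"
proof -
  let ?x = "z \<odot> z"
  let ?G = "gradient f ?x"
  have x: "?x \<in> unit_simplex" and le: "\<And>y. y \<in> unit_simplex \<Longrightarrow> f ?x \<le> f y"
    using min by (auto simp: is_arg_min_def not_less)
  have var: "0 \<le> (y - ?x) \<bullet> ?G" if "y \<in> unit_simplex" for y
    by (rule min_over_convex_GDERIV_nonneg[OF convex_unit_simplex x that le GDERIV_gradient[OF f]])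
  \<comment> \<open>The only possible multiplier: pairing the stationarity equation with the unit
    vector z yields exactly this value.\<close>
  define l where "l = ?x \<bullet> ?G"
  have ge: "l \<le> ?G $ i" for i
    using complementarity_if_minimizer(1)[OF x var] by (simp add: l_def)
  have "z $ i = 0 \<or> ?G $ i = l" for i
    using complementarity_if_minimizer(2)[OF x var, of i] by (simp add: l_def)
  then have "?G \<odot> z = l *\<^sub>R z"
    by (auto simp: vec_eq_iff)
  moreover have "(norm z)\<^sup>2 = 1"
    using x by (simp add: hadamard_self_in_unit_simplex)
  moreover have "2 * (?G \<bullet> (d \<odot> d)) - 2 * l * (norm d)\<^sup>2
          + 4 * ((z \<odot> d) \<bullet> (hessian f ?x *v (z \<odot> d))) \<ge> 0" for d
  proof -
    \<comment> \<open>Weighting \<open>l \<le> ?G $ i\<close> by the square of \<open>d $ i\<close>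
      and summing makes the first two terms together nonnegative; convexity handles the Hessian
      term.\<close>
    have "l * (norm d)\<^sup>2 = (\<Sum>i\<in>UNIV. l * (d $ i * d $ i))"
      by (simp add: power2_norm_eq_inner inner_vec_def sum_distrib_left)
    also have "\<dots> \<le> ?G \<bullet> (d \<odot> d)"
      unfolding inner_vec_def using ge by (intro sum_mono) (simp add: mult_right_mono)
    finally show ?thesis
      using convex_on_hessian_nonneg[OF assms(1-3), of "z \<odot> d" ?x] by simp
  qed
  ultimately show ?thesis
    unfolding second_order_KKT_def by blast
qed

theorem corollary2:
  fixes f :: "real ^ 'n \<Rightarrow> real" and z :: "real ^ 'n"
  assumes "twice_continuously_differentiable f"
    and "convex_on UNIV f"
  shows "second_order_KKT f z \<longleftrightarrow> is_arg_min f (\<lambda>x. x \<in> unit_simplex) (z \<odot> z)"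
  using second_order_KKT_imp_min[OF assms(2)] min_imp_second_order_KKT[OF assms(2)] assms(1)
  unfolding twice_continuously_differentiable_def by blast

end
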